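(* Let $\nu,N,m,\ell,n\in\mathbb{N}$, let $\mathbb{P}\subseteq\mathbb{C}^\nu$ be a compact set with $0\in\mathbb{P}$, let $E(p)\equiv I_N$, and let $A\colon\mathbb{P}\to\mathbb{C}^{N\times N}$, $B\colon\mathbb{P}\to\mathbb{C}^{N\times m}$, $C\colon\mathbb{P}\to\mathbb{C}^{\ell\times N}$ be holomorphic in $\mathbb{P}$. For $i=1,\ldots,n$ let $\lambda_i,\mu_i\colon\mathbb{P}\to\mathbb{C}$, $r_i\colon\mathbb{P}\to\mathbb{C}^m$, $\ell_i\colon\mathbb{P}\to\mathbb{C}^\ell$ be holomorphic with $\lambda_i(p),\mu_i(p)\notin\sigma(I_N,A(p))$ for all $p\in\mathbb{P}$. Let $A_i,\Lambda_i,B_i,R_i$ ($i\in\mathbb{N}_0^\nu$) denote the power series coefficients at $0$ of $A$, $\Lambda$, $B$, $R$. Then for each $\rho\in\mathbb{N}_0^\nu$ the Sylvester equation $$A_0V_\rho-V_\rho\Lambda_0+\sum_{\substack{i+j=\rho\\ j\neq\rho}}\bigl(A_iV_j-V_j\Lambda_i\bigr)+\sum_{i+j=\rho}B_iR_j=0$$ (sums over $i,j\in\mathbb{N}_0^\nu$), with the matrices $V_j\in\mathbb{C}^{N\times n}$ for $j\neq\rho$ occurring in it given, is uniquely solvable for $V_\rho\in\mathbb{C}^{N\times n}$.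
   Context: Multi-index notation: for $i=(i_1,\ldots,i_\nu)\in\mathbb{N}_0^\nu$ and $p=(p_1,\ldots,p_\nu)$, $p^i=\prod_{k=1}^\nu p_k^{i_k}$. The functions $A$, $\Lambda$, $B$, $R$ are expanded in power series around $0$, $$A(p)=\sum_{i\in\mathbb{N}_0^\nu}p^iA_i,\quad \Lambda(p)=\sum_{i\in\mathbb{N}_0^\nu}p^i\Lambda_i,\quad B(p)=\sum_{i\in\mathbb{N}_0^\nu}p^iB_i,\quad R(p)=\sum_{i\in\mathbb{N}_0^\nu}p^iR_i,$$ where $\Lambda(p)=\operatorname{diag}(\lambda_1(p),\ldots,\lambda_n(p))\in\mathbb{C}^{n\times n}$ and $R(p)=\begin{bmatrix}r_1(p)&\cdots&r_n(p)\end{bmatrix}\in\mathbb{C}^{m\times n}$; here the subscripts $\Lambda_i,R_i,A_i,B_i$ are power series coefficients indexed by multi-indices. The displayed equation of the claim is the coefficient of $p^\rho$ obtained by inserting these series and $V(p)=\sum_{i}p^iV_i$ into $A(p)V(p)-V(p)\Lambda(p)+B(p)R(p)=0$. The spectrum is $\sigma(I_N,A(p))=\{s\in\mathbb{C}\mid\operatorname{rank}(sI_N-A(p))<N\}$. A scalar function of several complex variables is holomorphic at $p$ if $\lim_{h\to0}(f(p+hq)-f(p))/h$ (with $h\in\mathbb{C}$) exists for every $q\in\mathbb{C}^\nu$; vector- and matrix-valued functions are holomorphic if all entries are. A function on the compact set $\mathbb{P}$ is called holomorphic in $\mathbb{P}$ if it is the restriction to $\mathbb{P}$ of a function holomorphic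 on an open neighborhood of $\mathbb{P}$ in $\mathbb{C}^\nu$; the power series coefficients at $0$ are the Taylor coefficients at $0$. *)

theory Defs
  imports "HOL-Analysis.Analysis"
begin

text \<open>
  The parameter space is \<open>complex ^ 'v\<close> and multi-indices have type \<open>nat ^ 'v\<close>, whose addition and
  zero are componentwise.
\<close>

lemma finite_multi_index_sum: "finite {(i, j). i + j = (\<rho> :: nat ^ 'v)}"
proof -
  let ?S = "{i :: nat ^ 'v. \<forall>k. i $ k \<le> \<rho> $ k}"
  have "finite (PiE (UNIV :: 'v set) (\<lambda>k. {..\<rho> $ k}))"
    by (intro finite_PiE) auto
  then have "finite (vec_lambda ` PiE (UNIV :: 'v set) (\<lambda>k. {..\<rho> $ k}))"
    by (rule finite_imageI)
  moreover have "?S \<subseteq> vec_lambda ` PiE (UNIV :: 'v set) (\<lambda>k. {..\<rho> $ k})"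
  proof
    fix i assume "i \<in> ?S"
    then have "vec_nth i \<in> PiE UNIV (\<lambda>k. {..\<rho> $ k})" by auto
    then show "i \<in> vec_lambda ` PiE UNIV (\<lambda>k. {..\<rho> $ k})"
      by (metis image_eqI vec_nth_inverse)
  qed
  ultimately have "finite ?S" by (rule finite_subset[rotated])
  then have "finite (?S \<times> ?S)" by simp
  moreover have "{(i, j). i + j = \<rho>} \<subseteq> ?S \<times> ?S" by auto
  ultimately show ?thesis by (rule finite_subset[rotated])
qed

definition mpow :: "complex ^ 'v \<Rightarrow> nat ^ 'v \<Rightarrow> complex"
  where "mpow p i = (\<Prod>k\<in>UNIV. (p $ k) ^ (i $ k))"

definition mholomorphic_at :: "(complex ^ 'v \<Rightarrow> complex) \<Rightarrow> complex ^ 'v \<Rightarrow> bool"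
  where "mholomorphic_at f p \<longleftrightarrow>
    (\<forall>q. \<exists>L. ((\<lambda>h::complex. (f (p + h *s q) - f p) / h) \<longlongrightarrow> L) (at 0))"

text \<open>
  A function on a compact set \<open>P\<close> is holomorphic in \<open>P\<close> if it is the restriction of a function that
  is holomorphic on an open neighbourhood of \<open>P\<close>. The (total) HOL function stands for such a
  holomorphic extension, so its values outside \<open>P\<close> matter only near \<open>P\<close>: they determine the power
  series at \<open>0\<close>, also when \<open>P\<close> is too thin around \<open>0\<close> for its values on \<open>P\<close> to do so.
\<close>

definition mholomorphic_in :: "(complex ^ 'v \<Rightarrow> complex) \<Rightarrow> (complex ^ 'v) set \<Rightarrow> bool"
  where "mholomorphic_in f P \<longleftrightarrow> (\<exists>U. open U \<and> P \<subseteq> U \<and> (\<forall>p\<in>U. mholomorphic_at f p))"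

definition vec_holomorphic_in :: "(complex ^ 'v \<Rightarrow> complex ^ 'a) \<Rightarrow> (complex ^ 'v) set \<Rightarrow> bool"
  where "vec_holomorphic_in f P \<longleftrightarrow> (\<forall>a. mholomorphic_in (\<lambda>p. f p $ a) P)"

definition mat_holomorphic_in ::
    "(complex ^ 'v \<Rightarrow> complex ^ 'b ^ 'a) \<Rightarrow> (complex ^ 'v) set \<Rightarrow> bool"
  where "mat_holomorphic_in F P \<longleftrightarrow> (\<forall>a b. mholomorphic_in (\<lambda>p. F p $ a $ b) P)"

text \<open>
  \<open>c\<close> is the family of power series coefficients of \<open>F\<close> at \<open>0\<close>. The sum is unconditional, as usual
  for multi-indexed series, and taken entrywise.
\<close>

definition has_power_series_coeffs ::
    "(complex ^ 'v \<Rightarrow> complex ^ 'b ^ 'a) \<Rightarrow> (nat ^ 'v \<Rightarrow> complex ^ 'b ^ 'a) \<Rightarrow> bool"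
  where "has_power_series_coeffs F c \<longleftrightarrow>
    (\<forall>\<^sub>F p in nhds 0. \<forall>a b. ((\<lambda>i. mpow p i * c i $ a $ b) has_sum F p $ a $ b) UNIV)"

definition pencil_spectrum :: "complex ^ 'N ^ 'N \<Rightarrow> complex ^ 'N ^ 'N \<Rightarrow> complex set"
  where "pencil_spectrum E A = {s. rank ((\<chi> i j. s * E $ i $ j) - A) < CARD('N)}"

definition diag_matrix :: "('n \<Rightarrow> complex) \<Rightarrow> complex ^ 'n ^ 'n"
  where "diag_matrix d = (\<chi> i j. if i = j then d i else 0)"

definition matrix_of_columns :: "('n \<Rightarrow> complex ^ 'm) \<Rightarrow> complex ^ 'n ^ 'm"
  where "matrix_of_columns r = (\<chi> a k. r k $ a)"

end

theory Submission
  imports Defs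
begin

text \<open>
  At \<open>p = 0\<close> every monomial except the constant one vanishes, so the coefficients at the multi-index
  \<open>0\<close> are the values of the functions there; in particular \<open>Ac 0 = A 0\<close> and \<open>Lc 0\<close> is diagonal with
  entries \<open>lam k 0\<close>. All other terms of the equation do not involve the unknown, so it has the form
  \<open>A 0 ** X - X ** diag_matrix d + K = 0\<close> with \<open>d k = lam k 0\<close>. Since the second coefficient is
  diagonal, this Sylvester equation decouples into one linear system
  \<open>(mat (d k) - A 0) *v x = column k K\<close> for each column \<open>x\<close> of \<open>X\<close>, and each of these systems
  is uniquely solvable because \<open>0 \<in> P\<close> and \<open>lam k 0\<close> does not lie in the spectrum of \<open>A 0\<close>.
\<close>

lemma mpow_0: "mpow 0 i = (if i = 0 then 1 else 0)"
  by (auto simp: mpow_def vec_eq_iff)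

lemma power_series_coeff_0:
  assumes "has_power_series_coeffs F c"
  shows "c 0 = F 0"
proof -
  have "c 0 $ a $ b = F 0 $ a $ b" for a b
  proof -
    have "((\<lambda>i. mpow 0 i * c i $ a $ b) has_sum F 0 $ a $ b) UNIV"
      using eventually_nhds_x_imp_x[OF assms[unfolded has_power_series_coeffs_def]] by blast
    moreover have "((\<lambda>i. mpow 0 i * c i $ a $ b) has_sum c 0 $ a $ b) UNIV"
      by (rule has_sum_finite_neutralI[where B = "{0}"]) (auto simp: mpow_0)
    ultimately show ?thesis
      using has_sum_unique by blast
  qed
  then show ?thesis
    by (simp add: vec_eq_iff)
qed

lemma full_rank_imp_invertible:
  fixes A :: "'a::field ^ 'n ^ 'n"
  assumes "\<not> rank A < CARD('n)"
  shows "invertible A"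
proof -
  have "vec.dim (UNIV :: ('a ^ 'n) set) \<le> vec.dim (rows A)"
    using assms by (simp add: row_rank_def_gen card_cart_basis vec.dimension_def vec.dim_UNIV)
  then have "vec.span (rows A) = UNIV"
    by (metis top_greatest vec.dim_eq_span vec.span_UNIV)
  then show ?thesis
    by (simp add: matrix_left_invertible_span_rows_gen invertible_left_inverse)
qed

lemma invertible_if_notin_pencil_spectrum:
  fixes A :: "complex ^ 'N ^ 'N"
  assumes "s \<notin> pencil_spectrum (mat 1) A"
  shows "invertible (mat s - A)"
proof -
  have "(\<chi> i j. s * (mat 1 :: complex ^ 'N ^ 'N) $ i $ j) = mat s"
    by (simp add: vec_eq_iff mat_def)
  with assms have "\<not> rank (mat s - A) < CARD('N)"
    by (simp add: pencil_spectrum_def)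
  then show ?thesis
    by (rule full_rank_imp_invertible)
qed

lemma column_sylvester_diag:
  fixes A :: "complex ^ 'N ^ 'N" and X K :: "complex ^ 'n ^ 'N"
  shows "column k (A ** X - X ** diag_matrix d + K) = column k K - (mat (d k) - A) *v column k X"
  by (simp add: vec_eq_iff column_def matrix_matrix_mult_def matrix_vector_mult_def diag_matrix_def
      mat_def left_diff_distrib sum_subtractf if_distrib[where f = "\<lambda>x. x * _"]
      if_distrib[where f = "(*) _"] sum.delta sum.delta' cong: if_cong)

lemma sylvester_diag_unique_solution:
  fixes A :: "complex ^ 'N ^ 'N" and K :: "complex ^ 'n ^ 'N"
  assumes inv: "\<And>k. invertible (mat (d k) - A)"
  shows "\<exists>!X :: complex ^ 'n ^ 'N. A ** X - X ** diag_matrix d + K = 0"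
proof -
  define W :: "complex ^ 'n ^ 'N"
    where "W = matrix_of_columns (\<lambda>k. matrix_inv (mat (d k) - A) *v column k K)"
  have W: "column k W = matrix_inv (mat (d k) - A) *v column k K" for k
    by (simp add: W_def matrix_of_columns_def column_def)
  have "A ** X - X ** diag_matrix d + K = 0 \<longleftrightarrow> X = W" for X
  proof -
    have ext: "Y = Z \<longleftrightarrow> (\<forall>k. column k Y = column k Z)" for Y Z :: "complex ^ 'n ^ 'N"
      by (auto simp: vec_eq_iff column_def)
    have "M *v x = y \<longleftrightarrow> x = matrix_inv M *v y" if "invertible M"
      for M :: "complex ^ 'N ^ 'N" and x y
      using someI_ex[OF that[unfolded invertible_def], folded matrix_inv_def]
      by (metis matrix_vector_mul_assoc matrix_vector_mul_lid)
    then have "(mat (d k) - A) *v column k X = column k K \<longleftrightarrow> column k X = column k W" for k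
      using inv W by simp
    moreover have "column k (0 :: complex ^ 'n ^ 'N) = 0" for k
      by (simp add: vec_eq_iff column_def)
    ultimately show ?thesis
      unfolding ext column_sylvester_diag by (metis eq_iff_diff_eq_0)
  qed
  then show ?thesis
    by simp
qed

theorem corollary4p1:
  fixes P :: "(complex ^ 'v) set"
    and A :: "complex ^ 'v \<Rightarrow> complex ^ 'N ^ 'N"
    and B :: "complex ^ 'v \<Rightarrow> complex ^ 'm ^ 'N"
    and C :: "complex ^ 'v \<Rightarrow> complex ^ 'N ^ 'l"
    and lam mu :: "'n::finite \<Rightarrow> complex ^ 'v \<Rightarrow> complex"
    and r :: "'n \<Rightarrow> complex ^ 'v \<Rightarrow> complex ^ 'm"
    and ell :: "'n \<Rightarrow> complex ^ 'v \<Rightarrow> complex ^ 'l"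
    and Ac :: "nat ^ 'v \<Rightarrow> complex ^ 'N ^ 'N"
    and Lc :: "nat ^ 'v \<Rightarrow> complex ^ 'n ^ 'n"
    and Bc :: "nat ^ 'v \<Rightarrow> complex ^ 'm ^ 'N"
    and Rc :: "nat ^ 'v \<Rightarrow> complex ^ 'n ^ 'm"
    and V :: "nat ^ 'v \<Rightarrow> complex ^ 'n ^ 'N"
    and \<rho> :: "nat ^ 'v"
  assumes "compact P" and "0 \<in> P"
    and "mat_holomorphic_in A P" and "mat_holomorphic_in B P" and "mat_holomorphic_in C P"
    and "\<And>k. mholomorphic_in (lam k) P" and "\<And>k. mholomorphic_in (mu k) P"
    and "\<And>k. vec_holomorphic_in (r k) P" and "\<And>k. vec_holomorphic_in (ell k) P"
    and "\<And>k p. p \<in> P \<Longrightarrow> lam k p \<notin> pencil_spectrum (mat 1) (A p)"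
    and "\<And>k p. p \<in> P \<Longrightarrow> mu k p \<notin> pencil_spectrum (mat 1) (A p)"
    and "has_power_series_coeffs A Ac"
    and "has_power_series_coeffs (\<lambda>p. diag_matrix (\<lambda>k. lam k p)) Lc"
    and "has_power_series_coeffs B Bc"
    and "has_power_series_coeffs (\<lambda>p. matrix_of_columns (\<lambda>k. r k p)) Rc"
  shows "\<exists>!V\<^sub>\<rho> :: complex ^ 'n ^ 'N.
    Ac 0 ** V\<^sub>\<rho> - V\<^sub>\<rho> ** Lc 0
    + (\<Sum>(i, j) \<in> {(i, j). i + j = \<rho> \<and> j \<noteq> \<rho>}. Ac i ** V j - V j ** Lc i)
    + (\<Sum>(i, j) \<in> {(i, j). i + j = \<rho>}. Bc i ** Rc j) = 0"
proof -
  have A0: "Ac 0 = A 0" and L0: "Lc 0 = diag_matrix (\<lambda>k. lam k 0)"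
    using assms by (auto dest: power_series_coeff_0)
  have "invertible (mat (lam k 0) - A 0)" for k
    using assms by (blast intro: invertible_if_notin_pencil_spectrum)
  then show ?thesis
    unfolding A0 L0 add.assoc by (rule sylvester_diag_unique_solution)
qed

end
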